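(* Let $\alpha > -1$ and $n \in \mathbb{N}$ be such that the Laguerre polynomials $L_{n-1}^{(\alpha+4)}(x)$ and $L_n^{(\alpha)}(x)$ have no common zeros. Let $x_1<x_2<\dots<x_n$ be the zeros of $L_n^{(\alpha)}(x)$ in increasing order, and let $q_+$ be the positive root of the quadratic equation $$n x^2 + 2n(\alpha+2)x - (\alpha+1)(\alpha+2)(\alpha+3) = 0.$$ (i) If $n\ge 4$, then at least $n-2$ of the $n-1$ intervals $(x_1,x_2),(x_2,x_3),\dots,(x_{n-1},x_n)$ contain exactly one zero of $L_{n-1}^{(\alpha+4)}(x)$. (ii) If $q_+ < x_1$ or $q_+ > x_n$, then the zeros of $L_{n-1}^{(\alpha+4)}(x)$ interlace with the $n$ zeros of $L_n^{(\alpha)}(x)$.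
   Context: $\mathbb{N}=\{1,2,3,\dots\}$. For $\alpha>-1$ and an integer $n\ge 0$, $L_n^{(\alpha)}(x)=\sum_{k=0}^{n}\binom{n+\alpha}{n-k}\frac{(-x)^k}{k!}$ is the Laguerre polynomial of degree $n$; the sequence $\{L_n^{(\alpha)}\}_{n\ge 0}$ is orthogonal on $(0,\infty)$ with respect to the weight $e^{-x}x^{\alpha}$, and $L_n^{(\alpha)}$ has $n$ real, simple, positive zeros. The zeros of two polynomials $p$ of degree $n-1$ and $q$ of degree $n$, each having only real simple zeros, are said to interlace if exactly one zero of $p$ lies strictly between each pair of successive zeros of $q$. *)

theory Defs
  imports Complex_Main "HOL-Computational_Algebra.Polynomial"
begin

definition laguerre :: "nat \<Rightarrow> real \<Rightarrow> real poly" where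
  "laguerre n \<alpha> =
     (\<Sum>k\<le>n. monom (((real n + \<alpha>) gchoose (n - k)) * (- 1) ^ k / fact k) k)"

text \<open>The quantifier ranges over the complex zeros, so the zero polynomial is excluded.\<close>

definition only_real_simple_zeros :: "real poly \<Rightarrow> bool" where
  "only_real_simple_zeros p \<longleftrightarrow>
     (\<forall>z::complex. poly (map_poly complex_of_real p) z = 0 \<longrightarrow>
        z \<in> \<real> \<and> order z (map_poly complex_of_real p) = 1)"

text \<open>
  The conditions under which interlacing is defined (consecutive degrees, only real simple
  zeros) are part of the predicate. For a linear \<open>q\<close> there is no pair of successive zeros.
\<close>

definition zeros_interlace :: "real poly \<Rightarrow> real poly \<Rightarrow> bool" where
  "zeros_interlace p q \<longleftrightarrow>
     degree q = degree p + 1 \<and>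
     only_real_simple_zeros p \<and> only_real_simple_zeros q \<and>
     (\<forall>a b. a < b \<and> poly q a = 0 \<and> poly q b = 0 \<and>
        (\<forall>c. a < c \<and> c < b \<longrightarrow> poly q c \<noteq> 0) \<longrightarrow>
        (\<exists>!z. a < z \<and> z < b \<and> poly p z = 0))"

end

theory Submission
  imports Defs
begin

text \<open>
  Write \<open>P\<close> for the Laguerre polynomial of degree \<open>n\<close> with parameter \<open>\<alpha>\<close>, and \<open>Q\<close> for the one of
  degree \<open>n - 1\<close> with parameter \<open>\<alpha> + 4\<close>. Then \<open>Q = - P' + 3 P'' - 3 P''' + P''''\<close>, and the
  Laguerre differential equation turns this into \<open>x\<^sup>3 Q(x) = q(x) P'(x)\<close> at the zeros of \<open>P\<close>,
  where \<open>q\<close> is the quadratic with positive root \<open>q\<^sub>+\<close>. Since \<open>P'\<close> alternates in sign along the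
  zeros of \<open>P\<close>, so does \<open>Q\<close>, except possibly across the one gap that contains \<open>q\<^sub>+\<close>. As \<open>Q\<close> has
  degree \<open>n - 1\<close>, no gap with a sign change has room for a second zero.
\<close>

section \<open>Laguerre polynomials: positivity, parameter shift, differential equation\<close>

lemma coeff_laguerre: "coeff (laguerre n a) k =
  (if k \<le> n then ((real n + a) gchoose (n - k)) * (- 1) ^ k / fact k else 0)"
  unfolding laguerre_def coeff_sum coeff_monom by (simp add: sum.delta)

lemma degree_laguerre [simp]: "degree (laguerre n a) = n"
proof (rule antisym)
  show "degree (laguerre n a) \<le> n"
    by (rule degree_le) (simp add: coeff_laguerre)
  show "n \<le> degree (laguerre n a)"
    by (rule le_degree) (simp add: coeff_laguerre)
qed

lemma laguerre_nonzero [simp]: "laguerre n a \<noteq> 0"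
proof
  assume "laguerre n a = 0"
  then have "coeff (laguerre n a) n = 0" by simp
  then show False by (simp add: coeff_laguerre)
qed

text \<open>All terms are nonnegative, since every factor in a binomial numerator is at least
  \<open>a + 1\<close>, and the constant term is positive even at \<open>x = 0\<close>. This puts
  the real zeros on the positive axis.\<close>

lemma laguerre_pos_of_nonpos:
  assumes "a > -1" "x \<le> 0"
  shows "poly (laguerre n a) x > 0"
proof -
  have pos: "((real n + a) gchoose m) > 0" if "m \<le> n" for m
    unfolding gbinomial_prod_rev
    using that assms by (intro divide_pos_pos prod_pos) auto
  have "poly (laguerre n a) x = (\<Sum>k\<le>n. ((real n + a) gchoose (n - k)) * (- x) ^ k / fact k)"
    by (simp add: laguerre_def poly_sum poly_monom power_minus[of x] mult_ac)
  also have "\<dots> > 0"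
    by (rule sum_pos2[of _ 0]) (use pos[of n] less_imp_le[OF pos] assms in auto)
  finally show ?thesis .
qed

lemma coeff_pderiv_laguerre: "coeff (pderiv (laguerre n a)) k =
  (if k < n then - (((real n + a) gchoose (n - Suc k)) * (- 1) ^ k / fact k) else 0)"
proof (cases "k < n")
  case True
  have "real (Suc k) / fact (Suc k) = 1 / fact k"
    by (simp del: of_nat_Suc)
  then have "real (Suc k) * (y / fact (Suc k)) = y / fact k" for y
    by (metis (no_types, opaque_lifting) mult.commute mult_1 times_divide_eq_left)
  with True show ?thesis
    by (simp add: coeff_pderiv coeff_laguerre del: fact_Suc of_nat_Suc)
qed (simp add: coeff_pderiv coeff_laguerre)

lemma pderiv_laguerre: "pderiv (laguerre (Suc n) a) = - laguerre n (a + 1)"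
  by (rule poly_eqI) (simp add: coeff_pderiv_laguerre coeff_laguerre add_ac)

text \<open>Pascal's rule, coefficient by coefficient. Iteration raises the parameter at fixed
  degree.\<close>

lemma laguerre_Suc_param: "laguerre n (a + 1) = laguerre n a - pderiv (laguerre n a)"
proof (rule poly_eqI)
  fix k
  have "(real n + (a + 1)) gchoose (n - k) =
     ((real n + a) gchoose (n - k)) + ((real n + a) gchoose (n - Suc k))" if "k < n"
    using gbinomial_Suc_Suc[of "real n + a" "n - Suc k"] that
    by (simp add: Suc_diff_Suc add_ac)
  then show "coeff (laguerre n (a + 1)) k = coeff (laguerre n a - pderiv (laguerre n a)) k"
    by (cases k n rule: linorder_cases)
       (simp_all add: coeff_pderiv_laguerre coeff_laguerre add_divide_distrib distrib_right)
qed

lemma laguerre_ODE: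
  "[:0, 1:] * pderiv (pderiv (laguerre n a)) + [:a + 1, -1:] * pderiv (laguerre n a)
     + smult (real n) (laguerre n a) = 0" (is "?lhs = 0")
proof (rule poly_eqI)
  fix k
  let ?c = "coeff (laguerre n a)" and ?d = "coeff (pderiv (laguerre n a))"
  \<comment> \<open>The factors \<open>x\<close> undo the index shifts of differentiation, so only
    the \<open>k\<close>-th coefficients of the polynomial and its derivative remain. What is left
    is the absorption identity for binomial coefficients.\<close>
  have lhs: "coeff ?lhs k = (real k + 1 + a) * ?d k + (real n - real k) * ?c k"
    by (cases k) (simp_all add: coeff_pderiv coeff_pCons algebra_simps)
  have "(real n - real k) * ((real n + a) gchoose (n - k)) =
      (real k + 1 + a) * ((real n + a) gchoose (n - Suc k))" if "k < n"
    using gbinomial_mult_1[of "real n + a" "n - Suc k"] that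
    by (simp add: Suc_diff_Suc of_nat_diff algebra_simps)
  then have "(real n - real k) * (((real n + a) gchoose (n - k)) * y) =
      (real k + 1 + a) * (((real n + a) gchoose (n - Suc k)) * y)" if "k < n" for y
    using that by (metis mult.assoc)
  from this[of "(- 1) ^ k / fact k"] show "coeff ?lhs k = coeff 0 k"
    unfolding lhs
    by (cases k n rule: linorder_cases) (simp_all add: coeff_laguerre coeff_pderiv_laguerre)
qed

lemma laguerre_zero_relation:
  assumes "n \<ge> 1" and "poly (laguerre n a) x = 0"
  shows "x ^ 3 * poly (laguerre (n - 1) (a + 4)) x =
    (real n * x ^ 2 + 2 * real n * (a + 2) * x - (a + 1) * (a + 2) * (a + 3))
      * poly (pderiv (laguerre n a)) x"
proof -
  define p where "p = laguerre n a"
  define d1 d2 d3 d4 where "d1 = pderiv p" and "d2 = pderiv d1" and "d3 = pderiv d2" and "d4 = pderiv d3"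
  note ds = d1_def d2_def d3_def d4_def
  obtain m where m: "n = Suc m" using assms(1) by (cases n) auto
  \<comment> \<open>Differentiation trades one degree for one parameter step; three applications of
    1 - d/dx supply the other three.\<close>
  have L1: "laguerre m (a + 1) = - d1"
    using pderiv_laguerre[of m a] by (simp add: ds p_def m)
  have L2: "laguerre m (a + 2) = - d1 + d2"
    using laguerre_Suc_param[of m "a + 1", unfolded add.assoc] by (simp add: L1 ds pderiv_minus)
  have L3: "laguerre m (a + 3) = (- d1 + d2) - (- d2 + d3)"
    using laguerre_Suc_param[of m "a + 2", unfolded add.assoc]
    by (simp add: L2 ds pderiv_minus pderiv_add pderiv_diff)
  have "laguerre m (a + 4) = laguerre m (a + 3) - pderiv (laguerre m (a + 3))"
    using laguerre_Suc_param[of m "a + 3", unfolded add.assoc] by simp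
  also have "\<dots> = (- d1 + d2) - (- d2 + d3) - ((- d2 + d3) - (- d3 + d4))"
    unfolding L3 pderiv_diff pderiv_add pderiv_minus ds ..
  finally have Q: "poly (laguerre (n - 1) (a + 4)) x =
      - poly d1 x + 3 * poly d2 x - 3 * poly d3 x + poly d4 x"
    by (simp add: m)
  \<comment> \<open>At a zero of \<open>p\<close>, this equation and its first two derivatives are
    linear in \<open>d1\<close>, ..., \<open>d4\<close>. Solving them successively for
    \<open>d2\<close>, \<open>d3\<close>, \<open>d4\<close> costs one factor \<open>x\<close> each,
    hence \<open>x ^ 3\<close>.\<close>
  have e0: "[:0, 1:] * d2 + [:a + 1, -1:] * d1 + smult (real n) p = 0"
    using laguerre_ODE[of n a] by (simp add: p_def ds)
  note pderivs = pderiv_add pderiv_diff pderiv_minus pderiv_mult pderiv_pCons pderiv_smult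
  have "x * poly d2 x + (a + 1 - x) * poly d1 x = 0"
    using arg_cong[OF e0, of "\<lambda>p. poly p x"] assms(2) by (simp add: p_def left_diff_distrib)
  moreover have "x * poly d3 x + (a + 2 - x) * poly d2 x + (real n - 1) * poly d1 x = 0"
    using arg_cong[OF e0, of "\<lambda>p. poly (pderiv p) x"]
    by (simp add: pderivs flip: ds) (simp add: pderivs algebra_simps flip: ds)
  moreover have "x * poly d4 x + (a + 3 - x) * poly d3 x + (real n - 2) * poly d2 x = 0"
    using arg_cong[OF e0, of "\<lambda>p. poly (pderiv (pderiv p)) x"]
    by (simp add: pderivs flip: ds) (simp add: pderivs algebra_simps flip: ds)
  ultimately show ?thesis
    unfolding Q p_def[symmetric] d1_def[symmetric] by algebra
qed

section \<open>Zeros located by sign changes\<close>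

lemma card_sign_changes_le_degree:
  fixes p :: "real poly" and x :: "nat \<Rightarrow> real"
  assumes "K \<subseteq> {1..<n}" and "strict_mono_on {1..n} x" and "p \<noteq> 0"
    and sign: "\<And>k. k \<in> K \<Longrightarrow> poly p (x k) * poly p (x (k + 1)) < 0"
  shows "card K \<le> degree p"
proof -
  \<comment> \<open>One zero per gap by the intermediate value theorem; the gaps are disjoint, so
    these zeros are distinct.\<close>
  have "\<exists>z. x k < z \<and> z < x (k + 1) \<and> poly p z = 0" if "k \<in> K" for k
    using poly_IVT[OF _ sign[OF that]] strict_mono_onD[OF assms(2), of k "k + 1"] assms(1) that by auto
  then obtain z where z: "\<And>k. k \<in> K \<Longrightarrow> x k < z k \<and> z k < x (k + 1) \<and> poly p (z k) = 0"
    by metis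
  have "z j < z k" if "j \<in> K" "k \<in> K" "j < k" for j k
  proof -
    have "x (j + 1) \<le> x k"
      using strict_mono_on_leD[OF assms(2), of "j + 1" k] that assms(1) by auto
    with z[of j] z[of k] that show ?thesis by linarith
  qed
  then have "inj_on z K"
    by (intro linorder_inj_onI) force+
  then have "card K = card (z ` K)" by (simp add: card_image)
  also have "\<dots> \<le> card {y. poly p y = 0}"
    using z \<open>p \<noteq> 0\<close> by (intro card_mono) (auto simp: poly_roots_finite)
  also have "\<dots> \<le> degree p" using \<open>p \<noteq> 0\<close> by (rule card_poly_roots_bound)
  finally show ?thesis .
qed

text \<open>
  Two zeros in a common gap can be divided out without affecting any sign change, which
  would leave a polynomial of too small degree; hence no multiplicities need to be counted.
\<close>

lemma unique_zero_of_sign_changes: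
  fixes p :: "real poly" and x :: "nat \<Rightarrow> real"
  assumes K: "K \<subseteq> {1..<n}" and mono: "strict_mono_on {1..n} x"
    and sign: "\<And>k. k \<in> K \<Longrightarrow> poly p (x k) * poly p (x (k + 1)) < 0"
    and deg: "degree p \<le> card K + 1" and k: "k \<in> K"
  shows "\<exists>!z. x k < z \<and> z < x (k + 1) \<and> poly p z = 0"
proof -
  have "x k < x (k + 1)"
    using strict_mono_onD[OF mono, of k "k + 1"] K k by auto
  from poly_IVT[OF this sign[OF k]] obtain z where
    z: "x k < z" "z < x (k + 1)" "poly p z = 0" by auto
  have less: False if rs: "x k < r" "r < s" "s < x (k + 1)" "poly p r = 0" "poly p s = 0" for r s
  proof -
    obtain u where u: "p = [:- r, 1:] * u"
      using rs by (auto simp: poly_eq_0_iff_dvd)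
    with rs have "poly u s = 0" by simp
    then obtain v where v: "u = [:- s, 1:] * v"
      by (auto simp: poly_eq_0_iff_dvd)
    have p: "poly p y = (y - r) * (y - s) * poly v y" for y
      by (simp add: u v algebra_simps)
    have "v \<noteq> 0" using sign[OF k] p by force
    \<comment> \<open>Both \<open>r\<close> and \<open>s\<close> lie inside gap \<open>k\<close>, so
      each \<open>x j\<close> is on the same side of both.\<close>
    have outside: "(x j - r) * (x j - s) > 0" if "j \<in> {1..n}" for j
    proof (cases "j \<le> k")
      case True
      then have "x j \<le> x k"
        using strict_mono_on_leD[OF mono, of j k] that K k by auto
      with rs show ?thesis by (intro mult_neg_neg) auto
    next
      case False
      then have "x (k + 1) \<le> x j"
        using strict_mono_on_leD[OF mono, of "k + 1" j] that K k by auto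
      with rs show ?thesis by (intro mult_pos_pos) auto
    qed
    have "poly v (x j) * poly v (x (j + 1)) < 0" if "j \<in> K" for j
    proof -
      have "((x j - r) * (x j - s)) * ((x (j + 1) - r) * (x (j + 1) - s)) > 0"
        using outside[of j] outside[of "j + 1"] that K by (intro mult_pos_pos[of "(x j - r) * (x j - s)"]) auto
      moreover have "((x j - r) * (x j - s)) * ((x (j + 1) - r) * (x (j + 1) - s))
          * (poly v (x j) * poly v (x (j + 1))) < 0"
        using sign[OF that] unfolding p by (simp only: mult_ac)
      ultimately show ?thesis by (metis mult_less_cancel_left_pos mult_zero_right)
    qed
    from card_sign_changes_le_degree[OF K mono \<open>v \<noteq> 0\<close> this] have "card K \<le> degree v" .
    \<comment> \<open>Now \<open>card K \<le> degree v = degree p - 2 \<le> card K - 1\<close>,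
      which is absurd.\<close>
    moreover have "degree p = degree v + 2"
      using \<open>v \<noteq> 0\<close> unfolding u v by (simp add: degree_mult_eq del: mult_pCons_left)
    ultimately show False using deg by simp
  qed
  show ?thesis
    using z less by (intro ex1I[of _ z]) (metis linorder_less_linear)+
qed

section \<open>Simple zeros and the derivative\<close>

lemma only_real_simple_zerosI:
  assumes "p \<noteq> 0" and "finite A" and "\<And>x. x \<in> A \<Longrightarrow> poly p x = 0" and "degree p \<le> card A"
  shows "only_real_simple_zeros p"
  unfolding only_real_simple_zeros_def
proof (intro allI impI)
  fix z :: complex
  define P where "P = map_poly complex_of_real p"
  assume "poly (map_poly complex_of_real p) z = 0"
  then obtain R where R: "P = [:- z, 1:] * R"
    by (auto simp: poly_eq_0_iff_dvd P_def)
  have deg: "degree P = degree p" by (simp add: P_def degree_map_poly)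
  have "P \<noteq> 0" using \<open>p \<noteq> 0\<close> unfolding P_def
    by (metis leading_coeff_0_iff of_real_eq_0_iff coeff_map_poly of_real_0 coeff_0)
  then have "R \<noteq> 0" using R by auto
  then have degP: "degree P = Suc (degree R)"
    by (simp add: R degree_mult_eq del: mult_pCons_left)
  have root: "poly P (of_real y) = 0" if "y \<in> A" for y
  proof -
    have "poly P (of_real y) = of_real (poly p y)"
      by (simp add: P_def poly_altdef degree_map_poly coeff_map_poly)
    with assms(3)[OF that] show ?thesis by simp
  qed
  \<comment> \<open>The cofactor \<open>R\<close> has too small a degree to vanish on all of
    \<open>A\<close>. A point of \<open>A\<close> where it does not vanish must be \<open>z\<close>
    itself, which makes \<open>z\<close> both real and simple.\<close>
  have *: "\<exists>y\<in>A. poly R (of_real y) \<noteq> 0"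
  proof (rule ccontr)
    assume "\<not> ?thesis"
    then have "card (complex_of_real ` A) \<le> card {y. poly R y = 0}"
      using \<open>R \<noteq> 0\<close> by (intro card_mono) (auto simp: poly_roots_finite)
    also have "\<dots> \<le> degree R" using \<open>R \<noteq> 0\<close> by (rule card_poly_roots_bound)
    finally have "card A \<le> degree R" by (simp add: card_image inj_on_def)
    then show False using assms(4) deg degP by simp
  qed
  then obtain y where y: "y \<in> A" "poly R (of_real y) \<noteq> 0" by blast
  then have zy: "z = of_real y" using root[of y] by (simp add: R)
  have "order z P = order z [:- z, 1:] + order z R"
    using \<open>P \<noteq> 0\<close> unfolding R by (rule order_mult)
  also have "order z R = 0" using y zy by (simp add: order_root)
  also have "order z [:- z, 1:] = 1" using order_power_n_n[of z 1] by simp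
  finally show "z \<in> \<real> \<and> order z (map_poly complex_of_real p) = 1"
    by (simp add: zy P_def)
qed

text \<open>With p = (X - a)(X - b)v, the factor v keeps one sign on [a, b], while the derivative is
  (a - b)v(a) at \<open>a\<close> and (b - a)v(b) at \<open>b\<close>.\<close>

lemma pderiv_sign_change_at_consecutive_zeros:
  fixes p :: "real poly"
  assumes "a < b" "poly p a = 0" "poly p b = 0" "\<And>c. a < c \<Longrightarrow> c < b \<Longrightarrow> poly p c \<noteq> 0"
    and simple: "poly (pderiv p) a \<noteq> 0" "poly (pderiv p) b \<noteq> 0"
  shows "poly (pderiv p) a * poly (pderiv p) b < 0"
proof -
  obtain u where u: "p = [:- a, 1:] * u"
    using assms by (auto simp: poly_eq_0_iff_dvd)
  with assms have "poly u b = 0" by simp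
  then obtain v where v: "u = [:- b, 1:] * v"
    by (auto simp: poly_eq_0_iff_dvd)
  have da: "poly (pderiv p) a = (a - b) * poly v a"
    unfolding u v pderiv_mult by (simp add: pderiv_pCons algebra_simps)
  have db: "poly (pderiv p) b = (b - a) * poly v b"
    unfolding u v pderiv_mult by (simp add: pderiv_pCons algebra_simps)
  have "poly v c \<noteq> 0" if "a < c" "c < b" for c
    using assms(4)[OF that] by (auto simp: u v)
  then have "\<not> poly v a * poly v b < 0"
    using poly_IVT[OF \<open>a < b\<close>, of v] by blast
  moreover have "poly v a \<noteq> 0" "poly v b \<noteq> 0" using simple da db by auto
  ultimately have "poly v a * poly v b > 0"
    by (metis linorder_neqE_linordered_idom no_zero_divisors)
  moreover have "poly (pderiv p) a * poly (pderiv p) b = - ((b - a)\<^sup>2 * (poly v a * poly v b))"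
    unfolding da db by (simp add: algebra_simps power2_eq_square)
  ultimately show ?thesis using \<open>a < b\<close> by simp
qed

section \<open>Sign changes between consecutive Laguerre zeros\<close>

theorem theorem4p2:
  fixes \<alpha> :: real and n :: nat and x :: "nat \<Rightarrow> real" and q_plus :: real
  assumes "\<alpha> > -1" and "n \<ge> 1"
    and no_common: "\<not> (\<exists>z. poly (laguerre (n - 1) (\<alpha> + 4)) z = 0 \<and> poly (laguerre n \<alpha>) z = 0)"
    and x_mono: "strict_mono_on {1..n} x"
    and x_zeros: "x ` {1..n} = {z. poly (laguerre n \<alpha>) z = 0}"
    and q_pos: "q_plus > 0"
    and q_root: "real n * q_plus ^ 2 + 2 * real n * (\<alpha> + 2) * q_plus
                   - (\<alpha> + 1) * (\<alpha> + 2) * (\<alpha> + 3) = 0"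
  shows "(n \<ge> 4 \<longrightarrow>
            card {k \<in> {1..n - 1}. \<exists>!z. x k < z \<and> z < x (k + 1) \<and>
                    poly (laguerre (n - 1) (\<alpha> + 4)) z = 0} \<ge> n - 2) \<and>
         (q_plus < x 1 \<or> q_plus > x n \<longrightarrow>
            zeros_interlace (laguerre (n - 1) (\<alpha> + 4)) (laguerre n \<alpha>))"
proof -
  define P where "P = laguerre n \<alpha>"
  define Q where "Q = laguerre (n - 1) (\<alpha> + 4)"
  define q where "q y = real n * y ^ 2 + 2 * real n * (\<alpha> + 2) * y
                   - (\<alpha> + 1) * (\<alpha> + 2) * (\<alpha> + 3)" for y
  have zero_x: "poly P (x k) = 0" if "k \<in> {1..n}" for k
    using x_zeros that by (auto simp: P_def)
  have x_pos: "x k > 0" if "k \<in> {1..n}" for k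
    using laguerre_pos_of_nonpos[OF \<open>\<alpha> > -1\<close>, of "x k" n] zero_x[OF that]
    by (force simp: P_def)
  have le: "x j \<le> x k" if "j \<in> {1..n}" "k \<in> {1..n}" "j \<le> k" for j k
    using strict_mono_on_leD[OF x_mono] that by blast
  have less: "x j < x k" if "j \<in> {1..n}" "k \<in> {1..n}" "j < k" for j k
    using strict_mono_onD[OF x_mono] that by blast
  have gap: "poly P c \<noteq> 0" if k: "k \<in> {1..<n}" and c: "x k < c" "c < x (k + 1)" for k c
  proof
    assume "poly P c = 0"
    then obtain j where j: "j \<in> {1..n}" "c = x j"
      using x_zeros unfolding P_def by blast
    show False
      using le[of j k] le[of "k + 1" j] j k c by (cases "j \<le> k") auto
  qed
  have rel: "x k ^ 3 * poly Q (x k) = q (x k) * poly (pderiv P) (x k)" if "k \<in> {1..n}" for k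
    using laguerre_zero_relation[OF \<open>n \<ge> 1\<close>, of \<alpha> "x k"] zero_x[OF that]
    by (simp add: P_def Q_def q_def)
  \<comment> \<open>The absence of common zeros makes the left side of \<open>rel\<close> nonzero,
    hence both factors on the right; in particular the zeros \<open>x k\<close> are simple.\<close>
  have nz: "q (x k) \<noteq> 0 \<and> poly (pderiv P) (x k) \<noteq> 0" if "k \<in> {1..n}" for k
  proof -
    have "poly Q (x k) \<noteq> 0"
      using no_common zero_x[OF that] by (auto simp: P_def Q_def)
    with x_pos[OF that] have "x k ^ 3 * poly Q (x k) \<noteq> 0" by simp
    then show ?thesis unfolding rel[OF that] by simp
  qed
  \<comment> \<open>By Vieta the other root is \<open>- q_plus - 2 * (\<alpha> + 2)\<close>, which
    is negative, so on the positive axis \<open>q\<close> changes sign only at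
    \<open>q_plus\<close>.\<close>
  have q_factor: "q y = real n * (y - q_plus) * (y + q_plus + 2 * (\<alpha> + 2))" for y
    using q_root unfolding q_def by algebra
  have sgn_q: "sgn (q y) = sgn (y - q_plus)" if "y > 0" for y
    using that q_pos \<open>\<alpha> > -1\<close> \<open>n \<ge> 1\<close> by (simp add: q_factor sgn_mult)
  have sign: "poly Q (x k) * poly Q (x (k + 1)) < 0"
    if k: "k \<in> {1..<n}" and q: "\<not> (x k < q_plus \<and> q_plus < x (k + 1))" for k
  proof -
    have k': "k \<in> {1..n}" "k + 1 \<in> {1..n}" using k by auto
    note pos = x_pos[OF k'(1)] x_pos[OF k'(2)]
    have D: "poly (pderiv P) (x k) * poly (pderiv P) (x (k + 1)) < 0"
      using less[of k "k + 1"] k' zero_x nz gap[OF k]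
      by (intro pderiv_sign_change_at_consecutive_zeros) auto
    have "x k \<noteq> q_plus" "x (k + 1) \<noteq> q_plus"
      using nz[OF k'(1)] nz[OF k'(2)] by (auto simp: q_factor)
    then have "sgn (q (x k)) * sgn (q (x (k + 1))) = 1"
      using q less[of k "k + 1"] k' unfolding sgn_q[OF pos(1)] sgn_q[OF pos(2)]
      by (auto simp: sgn_if)
    then have "q (x k) * q (x (k + 1)) > 0"
      by (metis sgn_mult sgn_1_pos)
    then have "(q (x k) * q (x (k + 1))) * (poly (pderiv P) (x k) * poly (pderiv P) (x (k + 1))) < 0"
      using D by (rule mult_pos_neg)
    also have "(q (x k) * q (x (k + 1))) * (poly (pderiv P) (x k) * poly (pderiv P) (x (k + 1)))
        = (x k ^ 3 * x (k + 1) ^ 3) * (poly Q (x k) * poly Q (x (k + 1)))"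
      using rel[OF k'(1)] rel[OF k'(2)] by algebra
    finally show ?thesis
      using pos by (simp add: mult_less_0_iff zero_less_mult_iff)
  qed
  have degQ: "degree Q = n - 1" by (simp add: Q_def)
  \<comment> \<open>The gaps with a guaranteed sign change of \<open>Q\<close>. Being disjoint, at
    most one of the \<open>n - 1\<close> gaps is left out, just what the bound
    \<open>n - 1 \<le> card K + 1\<close> allows.\<close>
  define K where "K = {k \<in> {1..<n}. \<not> (x k < q_plus \<and> q_plus < x (k + 1))}"
  have K: "K \<subseteq> {1..<n}" by (auto simp: K_def)
  have unique: "\<exists>!z. x k < z \<and> z < x (k + 1) \<and> poly Q z = 0" if "k \<in> K" "n - 1 \<le> card K + 1" for k
    using that degQ sign by (intro unique_zero_of_sign_changes[OF K x_mono]) (auto simp: K_def)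
  have cardK: "n - 2 \<le> card K"
  proof -
    have "j = k" if "j \<in> {1..<n} - K" "k \<in> {1..<n} - K" for j k
    proof (rule ccontr)
      assume "j \<noteq> k"
      then consider "j < k" | "k < j" by linarith
      then show False
        using le[of "j + 1" k] le[of "k + 1" j] that by cases (auto simp: K_def)
    qed
    then have "card ({1..<n} - K) \<le> 1"
      by (auto intro!: card_le_Suc0_iff_eq[THEN iffD2])
    then show ?thesis
      using card_Diff_subset[OF finite_subset[OF K] K] by simp
  qed
  have "card {k \<in> {1..n - 1}. \<exists>!z. x k < z \<and> z < x (k + 1) \<and> poly Q z = 0} \<ge> n - 2"
  proof (rule order_trans[OF cardK card_mono])
    show "K \<subseteq> {k \<in> {1..n - 1}. \<exists>!z. x k < z \<and> z < x (k + 1) \<and> poly Q z = 0}"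
      using unique cardK K by force
  qed simp
  moreover have "zeros_interlace Q P" if q: "q_plus < x 1 \<or> q_plus > x n"
  proof -
    have "\<not> (x k < q_plus \<and> q_plus < x (k + 1))" if "k \<in> {1..<n}" for k
      using q le[of 1 k] le[of "k + 1" n] that by auto
    then have K_eq: "K = {1..<n}" by (auto simp: K_def)
    have unique': "\<exists>!z. x k < z \<and> z < x (k + 1) \<and> poly Q z = 0" if "k \<in> {1..<n}" for k
      using unique[of k] that unfolding K_eq by simp
    have "card ({1..n}) = card (x ` {1..n})"
      using strict_mono_on_imp_inj_on[OF x_mono] by (simp add: card_image)
    then have P_simple: "only_real_simple_zeros P"
      using zero_x by (intro only_real_simple_zerosI[of P "x ` {1..n}"]) (auto simp: P_def)
    \<comment> \<open>The zeros found in the \<open>n - 1\<close> gaps already exhaust the degree of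
      \<open>Q\<close>.\<close>
    have Q_simple: "only_real_simple_zeros Q"
    proof -
      obtain z where z: "\<And>k. k \<in> {1..<n} \<Longrightarrow> x k < z k \<and> z k < x (k + 1) \<and> poly Q (z k) = 0"
        using unique' by metis
      have "z j < z k" if "j \<in> {1..<n}" "k \<in> {1..<n}" "j < k" for j k
        using le[of "j + 1" k] z[of j] z[of k] that by force
      then have "inj_on z {1..<n}"
        by (intro linorder_inj_onI) force+
      then have "card (z ` {1..<n}) = n - 1" by (simp add: card_image)
      then show ?thesis
        using z degQ by (intro only_real_simple_zerosI[of Q "z ` {1..<n}"]) (auto simp: Q_def)
    qed
    have "\<exists>!z. a < z \<and> z < b \<and> poly Q z = 0"
      if ab: "a < b" "poly P a = 0" "poly P b = 0" and no: "\<forall>c. a < c \<and> c < b \<longrightarrow> poly P c \<noteq> 0" for a b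
    proof -
      obtain j k where jk: "j \<in> {1..n}" "k \<in> {1..n}" "a = x j" "b = x k"
        using ab x_zeros unfolding P_def by blast
      have "j < k" using le[of k j] jk ab by force
      \<comment> \<open>Otherwise \<open>x (j + 1)\<close> would be a zero of \<open>P\<close>
        strictly between \<open>a\<close> and \<open>b\<close>.\<close>
      have "\<not> j + 1 < k"
      proof
        assume "j + 1 < k"
        then show False
          using no zero_x[of "j + 1"] less[of j "j + 1"] less[of "j + 1" k] jk by auto
      qed
      with \<open>j < k\<close> have "k = j + 1" by simp
      with unique'[of j] jk show ?thesis by auto
    qed
    with P_simple Q_simple show ?thesis
      unfolding zeros_interlace_def using degQ \<open>n \<ge> 1\<close> by (simp add: P_def)
  qed
  ultimately show ?thesis unfolding P_def Q_def by blast
qed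

end
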